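(* Let $n \geq 1$ be an integer, let $Q^n$ be the $n$-dimensional cube graph, and let $a_1, \ldots, a_n$ be any non-negative real numbers. Give each edge of $Q^n$ joining two vertices that differ exactly in the $i$th coordinate the weight $a_i$. Let $H$ be the subgraph of $Q^n$ induced by a subset of $2^{n-1}+1$ vertices. Then $\Delta_a(H) \geq \sqrt{a_1^2 + \cdots + a_n^2}$, where $\Delta_a(H)$ denotes the maximum weighted degree of the vertices of $H$.
   Context: The $n$-dimensional cube graph $Q^n$ has vertex set $\{0,1\}^n$ (so $2^n$ vertices), with an edge between two vertices exactly when they differ in exactly one coordinate. For a vertex $v$ and $1 \leq i \leq n$, let $v(i)$ be the unique vertex that differs from $v$ only in the $i$th coordinate; the neighbours of $v$ in $Q^n$ are precisely $v(1), \ldots, v(n)$, and the edge between $v$ and $v(i)$ has weight $a_i$. For a vertex $v$ of a subgraph $H$ of $Q^n$, the weighted degree of $v$ in $H$ is the sum of the weights of the edges of $H$ incident to $v$; when $H$ is induced by a vertex set $W \subseteq \{0,1\}^n$ and $v \in W$, this equals $\sum_{i \,:\, v(i) \in W} a_i$. $\Delta_a(H)$ is the maximum of the weighted degrees in $H$ over all vertices $v$ of $H$. *)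

theory Defs
  imports "HOL-Analysis.Analysis" "Graph_Theory.Digraph_Component"
begin

type_synonym vertex = "nat \<Rightarrow> nat"

text \<open>
  As in \<^theory>\<open>Graph_Theory.Digraph\<close>, an undirected simple graph is a symmetric digraph (predicate
  \<^const>\<open>graph\<close>): the edge between \<open>u\<close> and \<open>v\<close> is represented by the two arcs \<open>(u, v)\<close> and
  \<open>(v, u)\<close>. The elements of \<open>{0,1}\<^sup>n\<close> are functions on \<open>{1..n}\<close>, made \<^const>\<open>undefined\<close> outside
  \<open>{1..n}\<close> by \<^const>\<open>PiE\<close>.
\<close>

definition cube :: "nat \<Rightarrow> (vertex, vertex \<times> vertex) pre_digraph" where
  "cube n =
    \<lparr> verts = {1..n} \<rightarrow>\<^sub>E {0, 1},
      arcs = {(u, v). u \<in> {1..n} \<rightarrow>\<^sub>E {0, 1} \<and> v \<in> {1..n} \<rightarrow>\<^sub>E {0, 1} \<and>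
                (\<exists>!i. i \<in> {1..n} \<and> u i \<noteq> v i)},
      tail = fst, head = snd \<rparr>"

definition cube_weight :: "nat \<Rightarrow> (nat \<Rightarrow> real) \<Rightarrow> vertex \<times> vertex \<Rightarrow> real" where
  "cube_weight n a e = a (THE i. i \<in> {1..n} \<and> fst e i \<noteq> snd e i)"

text \<open>
  For a symmetric digraph every edge incident to \<open>v\<close> contributes exactly one arc leaving \<open>v\<close>, so
  summing over \<^const>\<open>out_arcs\<close> counts each incident edge once.
\<close>

definition weighted_degree :: "('b \<Rightarrow> real) \<Rightarrow> ('a, 'b) pre_digraph \<Rightarrow> 'a \<Rightarrow> real" where
  "weighted_degree w G v = (\<Sum>e\<in>out_arcs G v. w e)"

text \<open>Only meaningful for finite non-empty graphs, because of \<^const>\<open>Max\<close>.\<close>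

definition max_weighted_degree :: "('b \<Rightarrow> real) \<Rightarrow> ('a, 'b) pre_digraph \<Rightarrow> real" where
  "max_weighted_degree w G = Max (weighted_degree w G ` verts G)"

lemma graph_cube: "graph (cube n)"
proof -
  have fin: "finite ({1..n} \<rightarrow>\<^sub>E {0, 1::nat})"
    by (simp add: finite_PiE)
  have "finite (arcs (cube n))"
    by (rule finite_subset[OF _ finite_cartesian_product[OF fin fin]]) (auto simp: cube_def)
  moreover have "arcs_ends (cube n) = arcs (cube n)"
    by (simp add: cube_def arcs_ends_def arc_to_ends_def)
  moreover have "(v, u) \<in> arcs (cube n)" if "(u, v) \<in> arcs (cube n)" for u v
  proof -
    have "(\<lambda>i. i \<in> {1..n} \<and> v i \<noteq> u i) = (\<lambda>i. i \<in> {1..n} \<and> u i \<noteq> v i)"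
      by (rule ext) metis
    then show ?thesis using that by (simp add: cube_def del: atLeastAtMost_iff)
  qed
  ultimately have "finite (arcs (cube n))" "symmetric (cube n)"
    by (auto simp: symmetric_def intro: symI)
  moreover have "finite (verts (cube n))" using fin by (simp add: cube_def)
  moreover have "fst e \<in> verts (cube n) \<and> snd e \<in> verts (cube n) \<and> fst e \<noteq> snd e"
    if "e \<in> arcs (cube n)" for e
    using that by (cases e) (simp add: cube_def del: atLeastAtMost_iff, blast)
  moreover have "tail (cube n) = fst" "head (cube n) = snd" by (simp_all add: cube_def)
  ultimately show ?thesis
    by unfold_locales (simp_all add: arc_to_ends_def prod_eq_iff)
qed

lemma cube_weight_eq:
  assumes "e \<in> arcs (cube n)" "i \<in> {1..n}" "fst e i \<noteq> snd e i"
  shows "cube_weight n a e = a i"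
proof -
  have "\<exists>!i. i \<in> {1..n} \<and> fst e i \<noteq> snd e i"
    using assms(1) by (simp add: cube_def split_beta del: atLeastAtMost_iff)
  then have "(THE i. i \<in> {1..n} \<and> fst e i \<noteq> snd e i) = i"
    using assms(2,3) by (intro the1_equality conjI)
  then show ?thesis by (simp add: cube_weight_def)
qed

text \<open>The neighbours of \<open>v\<close> are the vertices \<open>v(i := 1 - v i)\<close>, written \<open>v(i)\<close> informally.\<close>

lemma weighted_degree_induced_cube:
  assumes W: "W \<subseteq> verts (cube n)" and v: "v \<in> W"
  shows "weighted_degree (cube_weight n a) (cube n \<restriction> W) v =
    (\<Sum>i | i \<in> {1..n} \<and> v(i := 1 - v i) \<in> W. a i)"
proof -
  let ?S = "{i \<in> {1..n}. v(i := 1 - v i) \<in> W}"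
  let ?f = "\<lambda>i. (v, v(i := 1 - v i))"
  have W': "W \<subseteq> {1..n} \<rightarrow>\<^sub>E {0, 1}" using W by (simp add: cube_def)
  note vE = subsetD[OF W' v] and WE = subsetD[OF W']
  have v01: "v i = 0 \<or> v i = 1" if "i \<in> {1..n}" for i
    using PiE_mem[OF vE that] by simp
  have flip: "1 - v i \<noteq> v i" if "i \<in> {1..n}" for i
    using v01[OF that] by auto
  have arc: "?f i \<in> arcs (cube n)" if "i \<in> ?S" for i
  proof -
    have "\<exists>!j. j \<in> {1..n} \<and> v j \<noteq> (v(i := 1 - v i)) j"
      using that flip[of i] by (intro ex1I[of _ i]) (auto split: if_splits)
    then show ?thesis using that vE WE[of "v(i := 1 - v i)"]
      by (simp add: cube_def del: atLeastAtMost_iff fun_upd_apply)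
  qed
  have inj: "inj_on ?f ?S"
  proof (rule inj_onI)
    fix i j assume "i \<in> ?S" "j \<in> ?S" and eq: "?f i = ?f j"
    then have "(v(i := 1 - v i)) i = (v(j := 1 - v j)) i" by simp
    then show "i = j" using flip[of i] \<open>i \<in> ?S\<close> by (auto split: if_splits)
  qed
  have img: "out_arcs (cube n \<restriction> W) v = ?f ` ?S"
  proof (intro equalityI subsetI)
    fix e assume "e \<in> out_arcs (cube n \<restriction> W) v"
    then obtain w where e: "e = (v, w)" and w: "w \<in> W" and "e \<in> arcs (cube n)"
      by (cases e) (auto simp: out_arcs_def cube_def)
    then have "\<exists>!i. i \<in> {1..n} \<and> v i \<noteq> w i" by (simp add: cube_def)
    then obtain i where i: "i \<in> {1..n}" "v i \<noteq> w i"
      and u: "\<And>j. j \<in> {1..n} \<Longrightarrow> v j \<noteq> w j \<Longrightarrow> j = i" by metis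
    have "w j = (v(i := 1 - v i)) j" for j
    proof (cases "j = i")
      case True
      then show ?thesis using i v01[of i] PiE_mem[OF WE[OF w], of i] by auto
    next
      case False
      moreover have "v j = w j" if "j \<in> {1..n}" using u[OF that] False by blast
      ultimately show ?thesis using PiE_arb[OF vE, of j] PiE_arb[OF WE[OF w], of j]
        by (cases "j \<in> {1..n}") simp_all
    qed
    then have "w = v(i := 1 - v i)" by blast
    then show "e \<in> ?f ` ?S" using e i(1) w by (intro image_eqI[of _ _ i]) simp_all
  next
    fix e assume "e \<in> ?f ` ?S"
    then obtain i where "i \<in> ?S" "e = ?f i" by blast
    then show "e \<in> out_arcs (cube n \<restriction> W) v"
      using arc[of i] v by (simp add: out_arcs_def cube_def del: atLeastAtMost_iff)
  qed
  have "cube_weight n a (?f i) = a i" if "i \<in> ?S" for i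
    using that flip[of i] by (intro cube_weight_eq[OF arc[OF that]]) auto
  then show ?thesis
    unfolding weighted_degree_def img sum.reindex[OF inj]
    by (intro sum.cong) (auto simp del: atLeastAtMost_iff)
qed

end

theory Submission
  imports Defs
begin

text \<open>
  Following Huang and Knuth, the edges of the cube are signed so that every 4-cycle has an odd
  number of negative edges. The signed weighted adjacency operator \<open>A\<close> then satisfies
  \<open>A\<^sup>2 = s\<^sup>2\<close> with \<open>s\<^sup>2 = \<Sum> a\<^sub>i\<^sup>2\<close>, so every function of the form \<open>f = A g + s g\<close> is an
  eigenfunction for \<open>s\<close>. If \<open>a\<^sub>k > 0\<close>, the map \<open>g \<mapsto> f\<close> is injective on the functions supported on
  the facet \<open>v\<^sub>k = 0\<close>; these form a space of dimension \<open>2\<^sup>n\<^sup>-\<^sup>1\<close>, while vanishing of \<open>f\<close> outside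
  \<open>W\<close> is only \<open>2\<^sup>n\<^sup>-\<^sup>1 - 1\<close> linear conditions. So some nonzero eigenfunction is supported on \<open>W\<close>,
  and the eigenvalue equation at a point of \<open>W\<close> where it is largest in modulus bounds \<open>s\<close> by the
  weighted degree there.
\<close>

text \<open>Gaussian elimination, by induction on the equations: a zero equation is dropped,
  otherwise one of its unknowns is eliminated from the others. \<open>U\<close> is finite because
  infinite sets have cardinality 0.\<close>

lemma homogeneous_system_nontrivial_solution:
  fixes c :: "'e \<Rightarrow> 'u \<Rightarrow> 'k::field"
  assumes "finite E" "card E < card U"
  shows "\<exists>x. (\<exists>u\<in>U. x u \<noteq> 0) \<and> (\<forall>e\<in>E. (\<Sum>u\<in>U. c e u * x u) = 0)"
  using assms
proof (induction E arbitrary: U c rule: finite_induct)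
  case empty
  then obtain u where "u \<in> U" by fastforce
  then show ?case by (intro exI[of _ "\<lambda>_. 1"]) auto
next
  case (insert e E)
  show ?case
  proof (cases "\<forall>u\<in>U. c e u = 0")
    case True
    obtain x where "\<exists>u\<in>U. x u \<noteq> 0" "\<forall>e\<in>E. (\<Sum>u\<in>U. c e u * x u) = 0"
      using insert.IH[of U c] insert.prems insert.hyps by auto
    then show ?thesis using True by (intro exI[of _ x]) auto
  next
    case False
    then obtain p where p: "p \<in> U" "c e p \<noteq> 0" by blast
    have fin: "finite U" using insert.prems by (intro card_ge_0_finite) simp
    define U' where "U' = U - {p}"
    have "card E < card U'"
      using insert.prems insert.hyps p fin by (simp add: U'_def)
    from insert.IH[OF this, of "\<lambda>d u. c d u - c d p * c e u / c e p"]
    obtain x where x: "\<exists>u\<in>U'. x u \<noteq> 0"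
      and x0: "\<And>d. d \<in> E \<Longrightarrow> (\<Sum>u\<in>U'. (c d u - c d p * c e u / c e p) * x u) = 0"
      by blast
    \<comment> \<open>The value at the pivot \<open>p\<close> is the one that equation
      \<open>e\<close> forces; the reduced equations then become the original ones.\<close>
    define y where "y = x(p := - (\<Sum>u\<in>U'. c e u * x u) / c e p)"
    have sum_y: "(\<Sum>u\<in>U. c d u * y u) =
        (\<Sum>u\<in>U'. c d u * x u) - c d p * (\<Sum>u\<in>U'. c e u * x u) / c e p" for d
    proof -
      have "(\<Sum>u\<in>U'. c d u * y u) = (\<Sum>u\<in>U'. c d u * x u)"
        by (intro sum.cong) (auto simp: y_def U'_def)
      then show ?thesis
        using sum.remove[OF fin p(1), of "\<lambda>u. c d u * y u"] by (simp add: y_def U'_def)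
    qed
    have "(\<Sum>u\<in>U. c d u * y u) = 0" if "d \<in> E" for d
      using x0[OF that] sum_y[of d]
      by (simp add: left_diff_distrib sum_subtractf sum_distrib_left sum_divide_distrib mult.assoc)
    moreover have "(\<Sum>u\<in>U. c e u * y u) = 0" using sum_y[of e] p(2) by simp
    moreover have "\<exists>u\<in>U. y u \<noteq> 0" using x by (auto simp: y_def U'_def)
    ultimately show ?thesis by blast
  qed
qed

text \<open>Adding the double sum to its transpose cancels all off-diagonal terms. Used to cancel
  the mixed terms of \<open>A\<close> squared.\<close>

lemma sum_antisym_off_diagonal:
  fixes T :: "'i \<Rightarrow> 'i \<Rightarrow> 'a::field_char_0"
  assumes "finite I" "\<And>i j. i \<in> I \<Longrightarrow> j \<in> I \<Longrightarrow> i \<noteq> j \<Longrightarrow> T i j = - T j i"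
  shows "(\<Sum>i\<in>I. \<Sum>j\<in>I. T i j) = (\<Sum>i\<in>I. T i i)"
proof -
  have "2 * (\<Sum>i\<in>I. \<Sum>j\<in>I. T i j) = (\<Sum>i\<in>I. \<Sum>j\<in>I. T i j) + (\<Sum>i\<in>I. \<Sum>j\<in>I. T j i)"
    unfolding mult_2 add_left_cancel by (rule sum.swap)
  also have "\<dots> = (\<Sum>i\<in>I. \<Sum>j\<in>I. if i = j then 2 * T i i else 0)"
    unfolding sum.distrib[symmetric]
  proof (intro sum.cong refl)
    fix i j assume "i \<in> I" "j \<in> I"
    then show "T i j + T j i = (if i = j then 2 * T i i else 0)"
      by (cases "i = j") (simp_all add: assms(2)[of i j])
  qed
  also have "\<dots> = 2 * (\<Sum>i\<in>I. T i i)" using assms(1) by (simp add: sum_distrib_left)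
  finally show ?thesis by simp
qed

text \<open>Subtraction on \<open>nat\<close> truncates, so this is an involution only where the
  coordinate is 0 or 1; hence the membership hypotheses below.\<close>

abbreviation flip :: "nat \<Rightarrow> vertex \<Rightarrow> vertex" where
  "flip i v \<equiv> v(i := 1 - v i)"

lemma cube_coord: "v \<in> verts (cube n) \<Longrightarrow> i \<in> {1..n} \<Longrightarrow> v i = 0 \<or> v i = 1"
  by (auto simp: cube_def dest!: PiE_mem)

lemma flip_in_cube: "v \<in> verts (cube n) \<Longrightarrow> i \<in> {1..n} \<Longrightarrow> flip i v \<in> verts (cube n)"
  using cube_coord[of v n i] by (auto simp: cube_def PiE_iff extensional_def)

lemma flip_flip: "v \<in> verts (cube n) \<Longrightarrow> i \<in> {1..n} \<Longrightarrow> flip i (flip i v) = v"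
  using cube_coord[of v n i] by auto

lemma card_cube_facet:
  assumes "k \<in> {1..n}"
  shows "card {v \<in> verts (cube n). v k = 0} = 2 ^ (n - 1)"
proof -
  have "{v \<in> verts (cube n). v k = 0} = PiE {1..n} (\<lambda>j. if j = k then {0} else {0, 1})"
    (is "?L = PiE _ ?F")
  proof (intro equalityI subsetI)
    fix v assume "v \<in> ?L"
    then show "v \<in> PiE {1..n} ?F" by (simp add: cube_def PiE_iff)
  next
    fix v assume v: "v \<in> PiE {1..n} ?F"
    have "v \<in> PiE {1..n} (\<lambda>_. {0, 1})" by (rule subsetD[OF PiE_mono v]) simp
    then show "v \<in> ?L" using PiE_mem[OF v assms] by (simp add: cube_def)
  qed
  moreover have "(\<Prod>j\<in>{1..n} - {k}. card (if j = k then {0} else {0, 1::nat})) = 2 ^ (n - 1)"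
    using assms by (simp add: numeral_2_eq_2)
  ultimately show ?thesis
    using prod.remove[OF _ assms, of "\<lambda>j. card (if j = k then {0} else {0, 1::nat})"]
    by (simp only: card_PiE finite_atLeastAtMost) simp
qed

text \<open>Closed form of the signs in Huang's recursive matrix, coordinate 1 being the outermost
  block. Only coordinates below \<open>i\<close> enter, so both ends of an edge in direction
  \<open>i\<close> give it the same sign.\<close>

definition edge_sign :: "vertex \<Rightarrow> nat \<Rightarrow> real" where
  "edge_sign v i = (\<Prod>j\<in>{1..<i}. (-1) ^ v j)"

lemma abs_edge_sign [simp]: "\<bar>edge_sign v i\<bar> = 1"
  by (simp add: edge_sign_def abs_prod power_abs)

lemma edge_sign_nonzero [simp]: "edge_sign v i \<noteq> 0"
  by (simp add: edge_sign_def)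

lemma edge_sign_square [simp]: "edge_sign v i * edge_sign v i = 1"
  using abs_mult_self_eq[of "edge_sign v i"] by simp

lemma edge_sign_flip_ge: "j \<le> i \<Longrightarrow> edge_sign (flip i v) j = edge_sign v j"
  by (auto simp: edge_sign_def intro!: prod.cong)

lemma edge_sign_flip_less:
  assumes "v \<in> verts (cube n)" "i \<in> {1..n}" "i < j"
  shows "edge_sign (flip i v) j = - edge_sign v j"
proof -
  have i: "i \<in> {1..<j}" using assms by simp
  have "(\<Prod>l\<in>{1..<j} - {i}. (-1) ^ flip i v l) = (\<Prod>l\<in>{1..<j} - {i}. (-1::real) ^ v l)"
    by (intro prod.cong) auto
  then show ?thesis
    using cube_coord[OF assms(1,2)] unfolding edge_sign_def
    by (subst (1 2) prod.remove[OF _ i]) auto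
qed

definition signed_adj :: "nat \<Rightarrow> (nat \<Rightarrow> real) \<Rightarrow> (vertex \<Rightarrow> real) \<Rightarrow> vertex \<Rightarrow> real" where
  "signed_adj n a f v = (\<Sum>i\<in>{1..n}. edge_sign v i * a i * f (flip i v))"

lemma signed_adj_add: "signed_adj n a (\<lambda>w. f w + g w) v = signed_adj n a f v + signed_adj n a g v"
  by (simp add: signed_adj_def distrib_left sum.distrib)

lemma signed_adj_scale: "signed_adj n a (\<lambda>w. c * f w) v = c * signed_adj n a f v"
  by (simp add: signed_adj_def sum_distrib_left mult_ac)

text \<open>The double sum runs over walks of length 2 from \<open>v\<close>. For distinct
  directions the two orders end at the same vertex with opposite signs; equal directions return to
  \<open>v\<close> with the sign squared.\<close>

lemma signed_adj_signed_adj: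
  assumes v: "v \<in> verts (cube n)"
  shows "signed_adj n a (signed_adj n a f) v = (\<Sum>i\<in>{1..n}. (a i)\<^sup>2) * f v"
proof -
  define T where "T i j = edge_sign v i * a i * (edge_sign (flip i v) j * a j * f (flip j (flip i v)))"
    for i j
  \<comment> \<open>Flipping the smaller coordinate \<open>i\<close> reverses the sign in direction
    \<open>j\<close>, but not the other way round: exactly one sign changes.\<close>
  have less: "T i j = - T j i" if "i \<in> {1..n}" "i < j" for i j
  proof -
    have "flip j (flip i v) = flip i (flip j v)" using that by (auto simp: fun_upd_twist)
    moreover have "edge_sign (flip i v) j = - edge_sign v j"
      using edge_sign_flip_less[OF v that] .
    moreover have "edge_sign (flip j v) i = edge_sign v i"
      using edge_sign_flip_ge[of i j v] that by simp
    ultimately show ?thesis unfolding T_def by (simp only: mult_ac mult_minus_left mult_minus_right)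
  qed
  have "T i j = - T j i" if "i \<in> {1..n}" "j \<in> {1..n}" "i \<noteq> j" for i j
    using less[of i j] less[of j i] that by (cases "i < j") auto
  then have "(\<Sum>i\<in>{1..n}. \<Sum>j\<in>{1..n}. T i j) = (\<Sum>i\<in>{1..n}. T i i)"
    by (rule sum_antisym_off_diagonal[OF finite_atLeastAtMost])
  also have "\<dots> = (\<Sum>i\<in>{1..n}. (a i)\<^sup>2 * f v)"
  proof (intro sum.cong refl)
    fix i assume "i \<in> {1..n}"
    then have "T i i = edge_sign v i * a i * (edge_sign v i * a i * f v)"
      unfolding T_def by (simp only: flip_flip[OF v] edge_sign_flip_ge order_refl)
    also have "\<dots> = (edge_sign v i * edge_sign v i) * (a i)\<^sup>2 * f v"
      by (simp only: power2_eq_square mult_ac)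
    finally show "T i i = (a i)\<^sup>2 * f v" by simp
  qed
  finally show ?thesis unfolding signed_adj_def T_def by (simp only: sum_distrib_left sum_distrib_right)
qed

lemma exists_eigenfunction_supported_on:
  assumes W: "W \<subseteq> verts (cube n)" "card W = 2 ^ (n - 1) + 1"
    and k: "k \<in> {1..n}" "a k \<noteq> 0"
    and s: "s\<^sup>2 = (\<Sum>i\<in>{1..n}. (a i)\<^sup>2)"
  shows "\<exists>f. (\<forall>v\<in>verts (cube n). signed_adj n a f v = s * f v) \<and>
    (\<forall>v\<in>verts (cube n) - W. f v = 0) \<and> (\<exists>v\<in>W. f v \<noteq> 0)"
proof -
  let ?V = "verts (cube n)"
  define U where "U = {v \<in> ?V. v k = 0}"
  have finV: "finite ?V" by (simp add: cube_def finite_PiE)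
  then have finU: "finite U" by (simp add: U_def)
  \<comment> \<open>The matrix entry of \<open>A + s I\<close> in row \<open>w\<close> and column
    \<open>u\<close>.\<close>
  define c where "c w u = signed_adj n a (\<lambda>v. of_bool (v = u)) w + s * of_bool (w = u)" for w u
  have "card ?V = 2 ^ n" by (simp add: cube_def card_PiE numeral_2_eq_2)
  moreover have "(2::nat) ^ n = 2 * 2 ^ (n - 1)" using k(1) by (cases n) auto
  ultimately have "card (?V - W) < card U"
    using W finV k(1) by (simp add: U_def card_cube_facet card_Diff_subset finite_subset)
  from homogeneous_system_nontrivial_solution[OF _ this, of c]
  obtain x where x: "\<exists>u\<in>U. x u \<noteq> 0" and x0: "\<And>w. w \<in> ?V - W \<Longrightarrow> (\<Sum>u\<in>U. c w u * x u) = 0"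
    using finV by auto
  define g where "g v = (if v \<in> U then x v else 0)" for v
  define f where "f v = signed_adj n a g v + s * g v" for v
  have g_expand: "g v = (\<Sum>u\<in>U. of_bool (v = u) * x u)" for v
    using finU by (auto simp: g_def of_bool_def if_distrib[of "\<lambda>y. y * _"] cong: if_cong)
  \<comment> \<open>By linearity of \<open>A\<close>; so the equations solved by \<open>x\<close>
    say that \<open>f\<close> vanishes outside \<open>W\<close>.\<close>
  have "(\<Sum>u\<in>U. c w u * x u) = f w" for w
  proof -
    have "(\<Sum>u\<in>U. signed_adj n a (\<lambda>v. of_bool (v = u)) w * x u) = signed_adj n a g w"
      unfolding signed_adj_def g_expand sum_distrib_left sum_distrib_right
      by (subst sum.swap) (simp only: mult.assoc)
    then show ?thesis
      by (simp add: c_def f_def distrib_right sum.distrib g_expand[of w] sum_distrib_left mult.assoc)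
  qed
  then have zero: "f w = 0" if "w \<in> ?V - W" for w using x0[OF that] by simp
  have eigen: "signed_adj n a f v = s * f v" if "v \<in> ?V" for v
  proof -
    have "signed_adj n a f v = signed_adj n a (signed_adj n a g) v + s * signed_adj n a g v"
      unfolding f_def by (simp add: signed_adj_add signed_adj_scale)
    also have "\<dots> = s * f v"
      using signed_adj_signed_adj[OF that, of a g]
      unfolding f_def s[symmetric] by (simp add: power2_eq_square distrib_left mult.assoc)
    finally show ?thesis .
  qed
  obtain u where u: "u \<in> U" "x u \<noteq> 0" using x by blast
  then have uV: "u \<in> ?V" and uk: "u k = 0" by (auto simp: U_def)
  \<comment> \<open>To see that \<open>f\<close> is nonzero, cross from the facet in direction
    \<open>k\<close>. Since \<open>w\<close> lies off the facet, \<open>g w = 0\<close>, and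
    \<open>u\<close> is its only neighbour on the facet, so a single term of \<open>f w\<close>
    survives.\<close>
  define w where "w = flip k u"
  have wV: "w \<in> ?V" using flip_in_cube[OF uV k(1)] by (simp add: w_def)
  have wk: "w k = 1" using uk by (simp add: w_def)
  have "signed_adj n a g w = (\<Sum>i\<in>{1..n}. if i = k then edge_sign w k * a k * x u else 0)"
    unfolding signed_adj_def
  proof (intro sum.cong refl)
    fix i assume "i \<in> {1..n}"
    show "edge_sign w i * a i * g (flip i w) = (if i = k then edge_sign w k * a k * x u else 0)"
    proof (cases "i = k")
      case True
      moreover have "flip k w = u" using flip_flip[OF uV k(1)] by (simp add: w_def)
      ultimately show ?thesis using u by (simp add: g_def)
    next
      case False
      then show ?thesis using wk by (simp add: g_def U_def)
    qed
  qed
  then have "f w = edge_sign w k * a k * x u"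
    using k(1) wk by (simp add: f_def g_def U_def)
  then have "f w \<noteq> 0" using u k(2) by simp
  then have "w \<in> W" using zero[of w] wV by blast
  then show ?thesis using eigen zero \<open>f w \<noteq> 0\<close> by blast
qed

lemma eigenvalue_le_max_weighted_degree:
  assumes a: "\<And>i. i \<in> {1..n} \<Longrightarrow> a i \<ge> 0"
    and W: "W \<subseteq> verts (cube n)" and s: "s \<ge> 0"
    and eigen: "\<And>v. v \<in> verts (cube n) \<Longrightarrow> signed_adj n a f v = s * f v"
    and zero: "\<And>v. v \<in> verts (cube n) - W \<Longrightarrow> f v = 0"
    and nonzero: "\<exists>v\<in>W. f v \<noteq> 0"
  shows "s \<le> max_weighted_degree (cube_weight n a) (cube n \<restriction> W)"
proof -
  have "finite (verts (cube n))" by (simp add: cube_def finite_PiE)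
  then have finW: "finite W" using W finite_subset by blast
  have "Max ((\<lambda>v. \<bar>f v\<bar>) ` W) \<in> (\<lambda>v. \<bar>f v\<bar>) ` W"
    using finW nonzero by (intro Max_in) auto
  then obtain v where v: "v \<in> W" and fv: "Max ((\<lambda>v. \<bar>f v\<bar>) ` W) = \<bar>f v\<bar>" by blast
  have max: "\<bar>f w\<bar> \<le> \<bar>f v\<bar>" if "w \<in> W" for w
    unfolding fv[symmetric] using finW that by (intro Max_ge) auto
  have pos: "\<bar>f v\<bar> > 0" using nonzero max by fastforce
  have vV: "v \<in> verts (cube n)" using v W by blast
  let ?S = "{i \<in> {1..n}. flip i v \<in> W}"
  have "s * \<bar>f v\<bar> = \<bar>signed_adj n a f v\<bar>" using eigen[OF vV] s by (simp add: abs_mult)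
  also have "\<dots> \<le> (\<Sum>i\<in>{1..n}. \<bar>edge_sign v i * a i * f (flip i v)\<bar>)"
    unfolding signed_adj_def by (rule sum_abs)
  also have "\<dots> = (\<Sum>i\<in>{1..n}. a i * \<bar>f (flip i v)\<bar>)"
    using a by (intro sum.cong) (simp_all add: abs_mult)
  \<comment> \<open>Neighbours outside \<open>W\<close> contribute 0, which turns the full degree
    into the degree in the induced subgraph.\<close>
  also have "\<dots> = (\<Sum>i\<in>?S. a i * \<bar>f (flip i v)\<bar>)"
    using zero flip_in_cube[OF vV] by (intro sum.mono_neutral_right) auto
  also have "\<dots> \<le> (\<Sum>i\<in>?S. a i * \<bar>f v\<bar>)"
    using a max by (intro sum_mono mult_left_mono) auto
  also have "\<dots> = weighted_degree (cube_weight n a) (cube n \<restriction> W) v * \<bar>f v\<bar>"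
    by (simp add: weighted_degree_induced_cube[OF W v] sum_distrib_right)
  finally have "s \<le> weighted_degree (cube_weight n a) (cube n \<restriction> W) v"
    using pos by simp
  also have "\<dots> \<le> max_weighted_degree (cube_weight n a) (cube n \<restriction> W)"
    unfolding max_weighted_degree_def using finW v by (intro Max_ge) auto
  finally show ?thesis .
qed

theorem theorem1p2:
  fixes n :: nat and a :: "nat \<Rightarrow> real" and W :: "vertex set"
    and H :: "(vertex, vertex \<times> vertex) pre_digraph"
  assumes "n \<ge> 1"
    and "\<And>i. i \<in> {1..n} \<Longrightarrow> a i \<ge> 0"
    and "W \<subseteq> verts (cube n)"
    and "card W = 2 ^ (n - 1) + 1"
    and "H = cube n \<restriction> W"
  shows "max_weighted_degree (cube_weight n a) H \<ge> sqrt (\<Sum>i = 1..n. (a i)\<^sup>2)"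
proof -
  let ?s = "sqrt (\<Sum>i = 1..n. (a i)\<^sup>2)"
  have s: "?s \<ge> 0" "?s\<^sup>2 = (\<Sum>i = 1..n. (a i)\<^sup>2)" by (simp_all add: sum_nonneg)
  have "\<exists>f. (\<forall>v\<in>verts (cube n). signed_adj n a f v = ?s * f v) \<and>
    (\<forall>v\<in>verts (cube n) - W. f v = 0) \<and> (\<exists>v\<in>W. f v \<noteq> 0)"
  proof (cases "\<exists>k\<in>{1..n}. a k \<noteq> 0")
    case True
    then show ?thesis using exists_eigenfunction_supported_on[OF assms(3,4) _ _ s(2)] by blast
  next
    \<comment> \<open>With all weights zero, both \<open>A\<close> and \<open>s\<close> vanish, so
      any nonzero function supported on \<open>W\<close> will do, for instance its
      indicator.\<close>
    case False
    have "W \<noteq> {}" using assms(4) by auto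
    with False show ?thesis
      by (intro exI[of _ "\<lambda>v. of_bool (v \<in> W)"]) (auto simp: signed_adj_def)
  qed
  then show ?thesis
    unfolding assms(5) using eigenvalue_le_max_weighted_degree[of n a W, OF assms(2,3) s(1)] by blast
qed

end
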